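(* Let $n\ge 1$ be an integer, let $q_0=1$ and $0<q_i<1$ for $i=1,\dots,n$, and let $a_0,a_1,\dots,a_n\in\mathbb{R}$. The exact solution of the differential equation with multiple proportional delays $$y'(x)=\sum_{i=0}^n a_i\,y(q_ix),\qquad y(0)=1,$$ is $$y(x)=1+\sum_{m=1}^\infty \frac{x^m}{m!}\prod_{j=0}^{m-1}\left(\sum_{i=0}^n a_iq_i^j\right).$$ *)

theory Defs
  imports "HOL-Analysis.Analysis"
begin

(* The one-sided derivative is meant at an endpoint belonging to I. The argument q i * x stays
   in I when I is an interval containing 0 and 0 \<le> q i \<le> 1. *)
definition is_delay_solution ::
  "nat \<Rightarrow> (nat \<Rightarrow> real) \<Rightarrow> (nat \<Rightarrow> real) \<Rightarrow> real set \<Rightarrow> (real \<Rightarrow> real) \<Rightarrow> bool" where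
  "is_delay_solution n a q I y \<longleftrightarrow>
     (\<forall>x\<in>I. (y has_real_derivative (\<Sum>i=0..n. a i * y (q i * x))) (at x within I)) \<and> y 0 = 1"

definition delay_term ::
  "nat \<Rightarrow> (nat \<Rightarrow> real) \<Rightarrow> (nat \<Rightarrow> real) \<Rightarrow> real \<Rightarrow> nat \<Rightarrow> real" where
  "delay_term n a q x m = x ^ m / fact m * (\<Prod>j=0..<m. \<Sum>i=0..n. a i * q i ^ j)"

end

theory Submission
  imports Defs
begin

text \<open>
  Write \<open>s j = (\<Sum>i=0..n. a i * q i ^ j)\<close> and let \<open>c m = (\<Prod>j<m. s j) / m!\<close> be the coefficients of
  the claimed solution. Substituting \<open>q i * x\<close> into a power series multiplies its coefficient of
  \<open>x ^ m\<close> by \<open>q i ^ m\<close>, so a power series with constant term \<open>1\<close> solves the equation if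
  \<open>(m + 1) * c (m + 1) = s m * c m\<close>, and this recursion is built into the product. Since
  \<open>0 \<le> q i \<le> 1\<close>, the numbers \<open>s j\<close> are bounded by \<open>A = (\<Sum>i=0..n. \<bar>a i\<bar>)\<close>; hence the series is dominated
  by that of \<open>exp (A * \<bar>x\<bar>)\<close>, converges everywhere and may be differentiated termwise
  (\<open>delay_series_has_derivative\<close>).

  For uniqueness, the difference of two solutions solves the same linear equation with initial
  value \<open>0\<close>. The delayed arguments lie between \<open>0\<close> and the current point, so bounds that
  increase with the distance from \<open>0\<close> can be integrated again and again, as in the Picard iteration: the
  difference is bounded by \<open>M * (A * \<bar>x\<bar>) ^ k / k!\<close> for every \<open>k\<close>, where \<open>M\<close> bounds it
  between \<open>0\<close> and \<open>x\<close>, hence it vanishes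
  (\<open>delay_homogeneous_zero\<close>).
\<close>

section \<open>The power series solution\<close>

definition delay_coeff :: "nat \<Rightarrow> (nat \<Rightarrow> real) \<Rightarrow> (nat \<Rightarrow> real) \<Rightarrow> nat \<Rightarrow> real" where
  "delay_coeff n a q m = (\<Prod>j=0..<m. \<Sum>i=0..n. a i * q i ^ j) / fact m"

definition delay_series :: "nat \<Rightarrow> (nat \<Rightarrow> real) \<Rightarrow> (nat \<Rightarrow> real) \<Rightarrow> real \<Rightarrow> real" where
  "delay_series n a q x = (\<Sum>m. delay_coeff n a q m * x ^ m)"

lemma delay_term_eq: "delay_term n a q x m = delay_coeff n a q m * x ^ m"
  by (simp add: delay_term_def delay_coeff_def)

lemma diffs_delay_coeff:
  "diffs (delay_coeff n a q) m = (\<Sum>i=0..n. a i * q i ^ m) * delay_coeff n a q m"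
  by (simp add: diffs_def delay_coeff_def divide_simps del: of_nat_Suc)

lemma abs_delay_coeff_le:
  assumes "\<And>i. i \<le> n \<Longrightarrow> 0 \<le> q i \<and> q i \<le> 1"
  shows "\<bar>delay_coeff n a q m\<bar> \<le> (\<Sum>i=0..n. \<bar>a i\<bar>) ^ m / fact m"
proof -
  have le: "\<bar>\<Sum>i=0..n. a i * q i ^ j\<bar> \<le> (\<Sum>i=0..n. \<bar>a i\<bar>)" for j
  proof -
    have "\<bar>\<Sum>i=0..n. a i * q i ^ j\<bar> \<le> (\<Sum>i=0..n. \<bar>a i * q i ^ j\<bar>)"
      by (rule sum_abs)
    also have "\<dots> \<le> (\<Sum>i=0..n. \<bar>a i\<bar>)"
      using assms by (intro sum_mono) (auto simp: abs_mult intro!: mult_left_le power_le_one)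
    finally show ?thesis .
  qed
  have "\<bar>\<Prod>j=0..<m. \<Sum>i=0..n. a i * q i ^ j\<bar> \<le> (\<Prod>j=0..<m. \<Sum>i=0..n. \<bar>a i\<bar>)"
    unfolding abs_prod by (rule prod_mono) (use le in auto)
  then show ?thesis
    by (simp add: delay_coeff_def divide_right_mono)
qed

lemma summable_delay_coeff:
  assumes "\<And>i. i \<le> n \<Longrightarrow> 0 \<le> q i \<and> q i \<le> 1"
  shows "summable (\<lambda>m. delay_coeff n a q m * x ^ m)"
proof (rule summable_comparison_test')
  show "summable (\<lambda>m. inverse (fact m) * ((\<Sum>i=0..n. \<bar>a i\<bar>) * \<bar>x\<bar>) ^ m)"
    by (rule summable_exp)
  show "norm (delay_coeff n a q m * x ^ m)
          \<le> inverse (fact m) * ((\<Sum>i=0..n. \<bar>a i\<bar>) * \<bar>x\<bar>) ^ m" for m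
    using mult_right_mono[OF abs_delay_coeff_le[OF assms, where m=m and a=a],
        where c="\<bar>x\<bar> ^ m"]
    by (simp add: abs_mult power_abs power_mult_distrib field_simps)
qed

lemma delay_series_0: "delay_series n a q 0 = 1"
  unfolding delay_series_def by (simp add: delay_coeff_def[of n a q 0])

lemma delay_series_eq:
  assumes "\<And>i. i \<le> n \<Longrightarrow> 0 \<le> q i \<and> q i \<le> 1"
  shows "delay_series n a q x = 1 + (\<Sum>m. delay_term n a q x (Suc m))"
  using suminf_split_head[OF summable_delay_coeff[OF assms, where x=x]]
  by (simp add: delay_series_def delay_term_eq) (simp add: delay_coeff_def)

lemma delay_series_has_derivative:
  assumes "\<And>i. i \<le> n \<Longrightarrow> 0 \<le> q i \<and> q i \<le> 1"
  shows "(delay_series n a q has_real_derivative (\<Sum>i=0..n. a i * delay_series n a q (q i * x)))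
           (at x within S)"
proof -
  note summ = summable_delay_coeff[OF assms, where a=a]
  have "(\<Sum>m. diffs (delay_coeff n a q) m * x ^ m)
          = (\<Sum>m. \<Sum>i=0..n. a i * (delay_coeff n a q m * (q i * x) ^ m))"
    by (simp add: diffs_delay_coeff sum_distrib_left sum_distrib_right power_mult_distrib mult_ac)
  also have "\<dots> = (\<Sum>i=0..n. \<Sum>m. a i * (delay_coeff n a q m * (q i * x) ^ m))"
    by (rule suminf_sum) (intro summable_mult summ, simp_all)
  also have "\<dots> = (\<Sum>i=0..n. a i * delay_series n a q (q i * x))"
    unfolding delay_series_def by (intro sum.cong refl suminf_mult summ, simp_all)
  finally have eq: "(\<Sum>m. diffs (delay_coeff n a q) m * x ^ m)
      = (\<Sum>i=0..n. a i * delay_series n a q (q i * x))" .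
  have "(delay_series n a q has_real_derivative (\<Sum>m. diffs (delay_coeff n a q) m * x ^ m)) (at x)"
    unfolding delay_series_def[abs_def] by (rule termdiffs_strong_converges_everywhere) (rule summ)
  then show ?thesis
    by (simp add: eq has_field_derivative_at_within)
qed

section \<open>Uniqueness\<close>

text \<open>
  The interval \<open>[0, 1]\<close> suffices for the general case: a solution along the segment from \<open>0\<close> to
  any \<open>x\<close>, of either sign, becomes a solution on \<open>[0, 1]\<close> after rescaling, at the cost of a factor
  \<open>x\<close> in the coefficients.
\<close>
lemma delay_homogeneous_zero_unit:
  fixes w :: "real \<Rightarrow> real"
  assumes q: "\<And>i. i \<le> n \<Longrightarrow> 0 \<le> q i \<and> q i \<le> 1"
    and deriv: "\<And>s. s \<in> {0..1} \<Longrightarrow>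
      (w has_real_derivative (\<Sum>i=0..n. b i * w (q i * s))) (at s within {0..1})"
    and "w 0 = 0"
  shows "w 1 = 0"
proof -
  define B where "B = (\<Sum>i=0..n. \<bar>b i\<bar>)"
  have B0: "0 \<le> B" unfolding B_def by (simp add: sum_nonneg)
  have cont: "continuous_on {0..1} w"
    using deriv by (rule DERIV_continuous_on)
  then have "bounded (w ` {0..1})"
    by (intro compact_imp_bounded compact_continuous_image) auto
  then obtain M where M0: "M > 0" and M: "\<And>s. s \<in> {0..1} \<Longrightarrow> \<bar>w s\<bar> \<le> M"
    by (auto simp: bounded_pos)
  have bound: "\<forall>s\<in>{0..1}. \<bar>w s\<bar> \<le> M * (B * s) ^ k / fact k" for k
  proof (induction k)
    case 0
    then show ?case using M by simp
  next
    case (Suc k)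
    \<comment> \<open>The next bound is the antiderivative of the bound on the derivative of \<open>w\<close> that the
      equation gives when the present bound is inserted at all delayed arguments.\<close>
    define u where "u t = M * (B * t) ^ Suc k / fact (Suc k)" for t :: real
    have u: "(u has_real_derivative B * (M * (B * t) ^ k / fact k)) (at t)" for t
    proof -
      have "(u has_real_derivative M * (real (Suc k) * (B * t) ^ k * B) / fact (Suc k)) (at t)"
        unfolding u_def by (auto intro!: derivative_eq_intros simp del: power_Suc of_nat_Suc fact_Suc)
      also have "M * (real (Suc k) * (B * t) ^ k * B) / fact (Suc k) = B * (M * (B * t) ^ k / fact k)"
        by (simp add: divide_simps del: of_nat_Suc)
      finally show ?thesis .
    qed
    have le: "\<bar>\<Sum>i=0..n. b i * w (q i * t)\<bar> \<le> B * (M * (B * t) ^ k / fact k)"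
      if t: "0 \<le> t" "t \<le> 1" for t
    proof -
      have each: "\<bar>w (q i * t)\<bar> \<le> M * (B * t) ^ k / fact k" if "i \<le> n" for i
      proof -
        have qt: "0 \<le> q i * t" "q i * t \<le> t" "q i * t \<le> 1"
          using q[OF that] t by (auto simp: mult_le_one mult_left_le_one_le)
        have "\<bar>w (q i * t)\<bar> \<le> M * (B * (q i * t)) ^ k / fact k"
          using Suc qt by simp
        also have "\<dots> \<le> M * (B * t) ^ k / fact k"
          using M0 B0 qt by (intro divide_right_mono mult_left_mono power_mono) auto
        finally show ?thesis .
      qed
      have "\<bar>\<Sum>i=0..n. b i * w (q i * t)\<bar> \<le> (\<Sum>i=0..n. \<bar>b i * w (q i * t)\<bar>)"
        by (rule sum_abs)
      also have "\<dots> \<le> (\<Sum>i=0..n. \<bar>b i\<bar> * (M * (B * t) ^ k / fact k))"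
        unfolding abs_mult using each by (intro sum_mono mult_left_mono) simp_all
      also have "\<dots> = B * (M * (B * t) ^ k / fact k)"
        by (subst (1) B_def) (rule sum_distrib_right[symmetric])
      finally show ?thesis .
    qed
    show ?case
    proof
      fix s :: real assume s: "s \<in> {0..1}"
      show "\<bar>w s\<bar> \<le> M * (B * s) ^ Suc k / fact (Suc k)"
      proof (cases "s = 0")
        case True
        then show ?thesis using \<open>w 0 = 0\<close> by simp
      next
        case False
        have "norm (w s - w 0) \<le> u s - u 0"
        proof (rule differentiable_bound_general[of 0 s w u
              "\<lambda>t. \<Sum>i=0..n. b i * w (q i * t)" "\<lambda>t. B * (M * (B * t) ^ k / fact k)"])
          show "0 < s" using False s by simp
          show "continuous_on {0..s} w"
            using cont s by (auto intro: continuous_on_subset)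
          show "continuous_on {0..s} u"
            unfolding u_def by (intro continuous_intros) simp
          fix t assume t: "0 < t" "t < s"
          with s have "at t within {0..1} = at t"
            by (intro at_within_interior) simp
          with deriv[of t] have "(w has_real_derivative (\<Sum>i=0..n. b i * w (q i * t))) (at t)"
            using t s by simp
          then show "(w has_vector_derivative (\<Sum>i=0..n. b i * w (q i * t))) (at t)"
            by (simp add: has_real_derivative_iff_has_vector_derivative)
          show "(u has_vector_derivative B * (M * (B * t) ^ k / fact k)) (at t)"
            using u by (simp add: has_real_derivative_iff_has_vector_derivative)
          show "norm (\<Sum>i=0..n. b i * w (q i * t)) \<le> B * (M * (B * t) ^ k / fact k)"
            using le[of t] t s by simp
        qed
        then show ?thesis using \<open>w 0 = 0\<close> by (simp add: u_def)
      qed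
    qed
  qed
  have "(\<lambda>k. M * (inverse (fact k) * B ^ k)) \<longlonglongrightarrow> M * 0"
    by (intro tendsto_mult tendsto_const summable_LIMSEQ_zero summable_exp)
  moreover have "\<bar>w 1\<bar> \<le> M * (inverse (fact k) * B ^ k)" for k
    using bspec[OF bound[of k], of 1] by (simp add: field_simps)
  ultimately have "\<bar>w 1\<bar> \<le> M * 0"
    using LIMSEQ_le_const by blast
  then show ?thesis by simp
qed

lemma delay_homogeneous_zero:
  fixes z :: "real \<Rightarrow> real"
  assumes q: "\<And>i. i \<le> n \<Longrightarrow> 0 \<le> q i \<and> q i \<le> 1"
    and I: "is_interval I" "0 \<in> I"
    and deriv: "\<And>x. x \<in> I \<Longrightarrow>
      (z has_real_derivative (\<Sum>i=0..n. a i * z (q i * x))) (at x within I)"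
    and z0: "z 0 = 0" and x: "x \<in> I"
  shows "z x = 0"
proof -
  have seg: "s * x \<in> I" if "s \<in> {0..1}" for s
    using that convexD[OF is_interval_convex[OF I(1)] I(2) x, of "1 - s" s] by simp
  have "z (1 * x) = 0"
  proof (rule delay_homogeneous_zero_unit[where w="\<lambda>s. z (s * x)" and b="\<lambda>i. x * a i", OF q])
    fix s :: real assume s: "s \<in> {0..1}"
    have "(z \<circ> (\<lambda>s. s * x) has_real_derivative (\<Sum>i=0..n. a i * z (q i * (s * x))) * x)
            (at s within {0..1})"
    proof (rule DERIV_image_chain)
      show "((\<lambda>s. s * x) has_real_derivative x) (at s within {0..1})"
        by (auto intro!: derivative_eq_intros)
      show "(z has_real_derivative (\<Sum>i=0..n. a i * z (q i * (s * x))))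
              (at (s * x) within (\<lambda>s. s * x) ` {0..1})"
        by (rule DERIV_subset[OF deriv[OF seg[OF s]]]) (use seg in auto)
    qed
    then show "((\<lambda>s. z (s * x)) has_real_derivative (\<Sum>i=0..n. x * a i * z (q i * s * x)))
            (at s within {0..1})"
      by (simp add: o_def sum_distrib_left mult_ac)
  qed (use z0 in simp_all)
  then show ?thesis by simp
qed

theorem mainTheorem2:
  fixes n :: nat and a q :: "nat \<Rightarrow> real" and I :: "real set"
  assumes "n \<ge> 1"
    and "q 0 = 1"
    and "\<And>i. 1 \<le> i \<Longrightarrow> i \<le> n \<Longrightarrow> 0 < q i \<and> q i < 1"
    and "is_interval I" and "0 \<in> I" and "I \<noteq> {0}"
  shows "(\<forall>x\<in>I. summable (\<lambda>m. delay_term n a q x (Suc m))) \<and>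
         (\<forall>y. is_delay_solution n a q I y \<longleftrightarrow>
              (\<forall>x\<in>I. y x = 1 + (\<Sum>m. delay_term n a q x (Suc m))))"
proof -
  have q: "0 \<le> q i \<and> q i \<le> 1" if "i \<le> n" for i
    using assms(2) assms(3)[of i] that by (cases "i = 0") auto
  show ?thesis
  proof (intro conjI ballI allI)
    fix x
    show "summable (\<lambda>m. delay_term n a q x (Suc m))"
      unfolding delay_term_eq
      by (subst summable_Suc_iff) (rule summable_delay_coeff[OF q])
  next
    let ?F = "delay_series n a q"
    note F' = delay_series_has_derivative[OF q, where a=a and S=I]
    fix y
    have "is_delay_solution n a q I y \<longleftrightarrow> (\<forall>x\<in>I. y x = ?F x)"
    proof
      assume y: "is_delay_solution n a q I y"
      show "\<forall>x\<in>I. y x = ?F x"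
      proof
        fix x assume x: "x \<in> I"
        have "y x - ?F x = 0"
        proof (rule delay_homogeneous_zero[where z="\<lambda>x. y x - ?F x", OF q assms(4,5) _ _ x])
          fix t assume "t \<in> I"
          then have "(y has_real_derivative (\<Sum>i=0..n. a i * y (q i * t))) (at t within I)"
            using y by (simp add: is_delay_solution_def)
          from DERIV_diff[OF this F']
          show "((\<lambda>x. y x - ?F x) has_real_derivative
                  (\<Sum>i=0..n. a i * (y (q i * t) - ?F (q i * t)))) (at t within I)"
            by (simp add: right_diff_distrib sum_subtractf)
        qed (use y in \<open>simp_all add: is_delay_solution_def delay_series_0\<close>)
        then show "y x = ?F x" by simp
      qed
    next
      assume y: "\<forall>x\<in>I. y x = ?F x"
      have "(y has_real_derivative (\<Sum>i=0..n. a i * y (q i * x))) (at x within I)"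
        if x: "x \<in> I" for x
      proof -
        \<comment> \<open>The equation evaluates \<open>y\<close> at \<open>q i * x\<close>, where \<open>y\<close> agrees with the series only because this
          point is in \<open>I\<close>.\<close>
        have "q i * x \<in> I" if "i \<le> n" for i
          using q[OF that] convexD[OF is_interval_convex[OF assms(4)] assms(5) x, of "1 - q i" "q i"]
          by simp
        then have "(\<Sum>i=0..n. a i * y (q i * x)) = (\<Sum>i=0..n. a i * ?F (q i * x))"
          using y by (intro sum.cong) auto
        with F'[where x=x]
        have "(?F has_real_derivative (\<Sum>i=0..n. a i * y (q i * x))) (at x within I)"
          by simp
        then show ?thesis
          unfolding has_field_derivative_def
          by (rule has_derivative_transform[OF x, rotated]) (use y in simp)
      qed
      then show "is_delay_solution n a q I y"
        using y assms(5) by (simp add: is_delay_solution_def delay_series_0)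
    qed
    then show "is_delay_solution n a q I y \<longleftrightarrow>
        (\<forall>x\<in>I. y x = 1 + (\<Sum>m. delay_term n a q x (Suc m)))"
      by (simp add: delay_series_eq[OF q])
  qed
qed

end
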